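(* Let $\mathcal{A}$ be an abelian category which is bicomplete and locally small. Then $Pr(\mathcal{A})$ is a complete lattice, in the sense that every collection (not necessarily a set) of preradicals of $\mathcal{A}$ has a least upper bound and a greatest lower bound in $Pr(\mathcal{A})$.
   Context: Bicomplete means complete and cocomplete; locally small means that the class of subobjects of each object is a set. A preradical of an abelian category $\mathcal{A}$ is a subobject of the identity functor $1_{\mathcal{A}}$ in the (possibly extended) abelian category $\mathrm{Fun}(\mathcal{A},\mathcal{A})$, i.e. the equivalence class of a monomorphic natural transformation $\tau:T\hookrightarrow 1_{\mathcal{A}}$, two such being equivalent if each factors through the other. $Pr(\mathcal{A})$ is the collection (not necessarily a set) of preradicals, ordered by $\tau\leq\sigma$ iff $\tau$ factors through $\sigma$. *)

theory Defs
  imports "HOL-Algebra.Group" "HOL-Library.Equipollence"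
begin

section \<open>Categories\<close>

record ('o, 'a) cat =
  Obj :: "'o set"
  Arr :: "'a set"
  Dom :: "'a \<Rightarrow> 'o"
  Cod :: "'a \<Rightarrow> 'o"
  Idt :: "'o \<Rightarrow> 'a"
  Cmp :: "'a \<Rightarrow> 'a \<Rightarrow> 'a"  (infixr \<open>\<odot>\<index>\<close> 70)

definition Hom :: "('o, 'a) cat \<Rightarrow> 'o \<Rightarrow> 'o \<Rightarrow> 'a set" where
  "Hom C x y = {f \<in> Arr C. Dom C f = x \<and> Cod C f = y}"

text \<open>Composition is in the applicative order: \<open>g \<odot> f\<close> is \<open>f\<close> followed by \<open>g\<close>.\<close>

locale category =
  fixes C :: "('o, 'a) cat" (structure)
  assumes dom_obj: "f \<in> Arr C \<Longrightarrow> Dom C f \<in> Obj C"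
    and cod_obj: "f \<in> Arr C \<Longrightarrow> Cod C f \<in> Obj C"
    and idt_hom: "x \<in> Obj C \<Longrightarrow> Idt C x \<in> Hom C x x"
    and cmp_hom: "\<lbrakk>f \<in> Hom C x y; g \<in> Hom C y z\<rbrakk> \<Longrightarrow> g \<odot> f \<in> Hom C x z"
    and cmp_idt_left: "f \<in> Hom C x y \<Longrightarrow> Idt C y \<odot> f = f"
    and cmp_idt_right: "f \<in> Hom C x y \<Longrightarrow> f \<odot> Idt C x = f"
    and cmp_assoc: "\<lbrakk>f \<in> Hom C w x; g \<in> Hom C x y; h \<in> Hom C y z\<rbrakk>
                    \<Longrightarrow> (h \<odot> g) \<odot> f = h \<odot> (g \<odot> f)"

definition op_cat :: "('o, 'a) cat \<Rightarrow> ('o, 'a) cat" where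
  "op_cat C = \<lparr>Obj = Obj C, Arr = Arr C, Dom = Cod C, Cod = Dom C, Idt = Idt C,
               Cmp = (\<lambda>g f. f \<odot>\<^bsub>C\<^esub> g)\<rparr>"

definition mono_arr :: "('o, 'a) cat \<Rightarrow> 'a \<Rightarrow> bool" where
  "mono_arr C m \<longleftrightarrow> m \<in> Arr C \<and>
     (\<forall>w\<in>Obj C. \<forall>f\<in>Hom C w (Dom C m). \<forall>g\<in>Hom C w (Dom C m).
        m \<odot>\<^bsub>C\<^esub> f = m \<odot>\<^bsub>C\<^esub> g \<longrightarrow> f = g)"

definition epi_arr :: "('o, 'a) cat \<Rightarrow> 'a \<Rightarrow> bool" where
  "epi_arr C e \<longleftrightarrow> mono_arr (op_cat C) e"


section \<open>Functors and natural transformations\<close>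

text \<open>Functors and transformations are extensional, i.e. \<open>undefined\<close> outside the objects and
  arrows of the source category, so that equality of records is equality of functors and of
  transformations.  No size restriction is placed on the source of a functor category.\<close>

record ('o, 'a, 'p, 'b) ftr =
  OMap :: "'o \<Rightarrow> 'p"
  AMap :: "'a \<Rightarrow> 'b"

definition is_ftr :: "('o, 'a) cat \<Rightarrow> ('p, 'b) cat \<Rightarrow> ('o, 'a, 'p, 'b) ftr \<Rightarrow> bool" where
  "is_ftr C D F \<longleftrightarrow>
     OMap F \<in> Obj C \<rightarrow>\<^sub>E Obj D \<and> AMap F \<in> Arr C \<rightarrow>\<^sub>E Arr D \<and>
     (\<forall>x\<in>Obj C. \<forall>y\<in>Obj C. \<forall>f\<in>Hom C x y. AMap F f \<in> Hom D (OMap F x) (OMap F y)) \<and>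
     (\<forall>x\<in>Obj C. AMap F (Idt C x) = Idt D (OMap F x)) \<and>
     (\<forall>f\<in>Arr C. \<forall>g\<in>Arr C. Cod C f = Dom C g \<longrightarrow>
        AMap F (g \<odot>\<^bsub>C\<^esub> f) = AMap F g \<odot>\<^bsub>D\<^esub> AMap F f)"

definition id_ftr :: "('o, 'a) cat \<Rightarrow> ('o, 'a, 'o, 'a) ftr" where
  "id_ftr C = \<lparr>OMap = restrict (\<lambda>x. x) (Obj C), AMap = restrict (\<lambda>f. f) (Arr C)\<rparr>"

record ('o, 'a, 'p, 'b) ntr =
  Src :: "('o, 'a, 'p, 'b) ftr"
  Trg :: "('o, 'a, 'p, 'b) ftr"
  At :: "'o \<Rightarrow> 'b"

definition is_ntr :: "('o, 'a) cat \<Rightarrow> ('p, 'b) cat \<Rightarrow> ('o, 'a, 'p, 'b) ntr \<Rightarrow> bool" where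
  "is_ntr C D t \<longleftrightarrow>
     is_ftr C D (Src t) \<and> is_ftr C D (Trg t) \<and>
     At t \<in> (\<Pi>\<^sub>E x\<in>Obj C. Hom D (OMap (Src t) x) (OMap (Trg t) x)) \<and>
     (\<forall>f\<in>Arr C. At t (Cod C f) \<odot>\<^bsub>D\<^esub> AMap (Src t) f = AMap (Trg t) f \<odot>\<^bsub>D\<^esub> At t (Dom C f))"

definition Fun_cat ::
  "('o, 'a) cat \<Rightarrow> ('p, 'b) cat \<Rightarrow> (('o, 'a, 'p, 'b) ftr, ('o, 'a, 'p, 'b) ntr) cat" where
  "Fun_cat C D =
     \<lparr>Obj = {F. is_ftr C D F}, Arr = {t. is_ntr C D t}, Dom = Src, Cod = Trg,
      Idt = (\<lambda>F. \<lparr>Src = F, Trg = F, At = restrict (\<lambda>x. Idt D (OMap F x)) (Obj C)\<rparr>),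
      Cmp = (\<lambda>s t. \<lparr>Src = Src t, Trg = Trg s,
                    At = restrict (\<lambda>x. At s x \<odot>\<^bsub>D\<^esub> At t x) (Obj C)\<rparr>)\<rparr>"


section \<open>Subobjects\<close>

definition monos_into :: "('o, 'a) cat \<Rightarrow> 'o \<Rightarrow> 'a set" where
  "monos_into C x = {m. mono_arr C m \<and> Cod C m = x}"

definition factors_through :: "('o, 'a) cat \<Rightarrow> 'a \<Rightarrow> 'a \<Rightarrow> bool" where
  "factors_through C m n \<longleftrightarrow> (\<exists>h\<in>Hom C (Dom C m) (Dom C n). m = n \<odot>\<^bsub>C\<^esub> h)"

definition sub_equiv :: "('o, 'a) cat \<Rightarrow> 'o \<Rightarrow> ('a \<times> 'a) set" where
  "sub_equiv C x = {(m, n). m \<in> monos_into C x \<and> n \<in> monos_into C x \<and>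
                            factors_through C m n \<and> factors_through C n m}"

definition subobjects :: "('o, 'a) cat \<Rightarrow> 'o \<Rightarrow> 'a set set" where
  "subobjects C x = monos_into C x // sub_equiv C x"

definition Sub :: "('o, 'a) cat \<Rightarrow> 'o \<Rightarrow> 'a set gorder" where
  "Sub C x = \<lparr>carrier = subobjects C x, eq = (=),
              le = (\<lambda>P Q. \<exists>m\<in>P. \<exists>n\<in>Q. factors_through C m n)\<rparr>"

definition Pr :: "('o, 'a) cat \<Rightarrow> ('o, 'a, 'o, 'a) ntr set gorder" where
  "Pr C = Sub (Fun_cat C C) (id_ftr C)"


section \<open>Abelian categories\<close>

definition null_object :: "('o, 'a) cat \<Rightarrow> 'o \<Rightarrow> bool" where
  "null_object C z \<longleftrightarrow> z \<in> Obj C \<and>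
     (\<forall>x\<in>Obj C. (\<exists>!f. f \<in> Hom C x z) \<and> (\<exists>!f. f \<in> Hom C z x))"

definition zero_arr :: "('o, 'a) cat \<Rightarrow> 'a \<Rightarrow> bool" where
  "zero_arr C f \<longleftrightarrow> f \<in> Arr C \<and>
     (\<exists>z g h. null_object C z \<and> g \<in> Hom C (Dom C f) z \<and> h \<in> Hom C z (Cod C f) \<and>
              f = h \<odot>\<^bsub>C\<^esub> g)"

definition is_kernel :: "('o, 'a) cat \<Rightarrow> 'a \<Rightarrow> 'a \<Rightarrow> bool" where
  "is_kernel C k f \<longleftrightarrow> f \<in> Arr C \<and> k \<in> Arr C \<and> Cod C k = Dom C f \<and> zero_arr C (f \<odot>\<^bsub>C\<^esub> k) \<and>
     (\<forall>h\<in>Arr C. Cod C h = Dom C f \<and> zero_arr C (f \<odot>\<^bsub>C\<^esub> h) \<longrightarrow>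
        (\<exists>!u. u \<in> Hom C (Dom C h) (Dom C k) \<and> h = k \<odot>\<^bsub>C\<^esub> u))"

definition is_cokernel :: "('o, 'a) cat \<Rightarrow> 'a \<Rightarrow> 'a \<Rightarrow> bool" where
  "is_cokernel C q f \<longleftrightarrow> is_kernel (op_cat C) q f"

definition preadditive :: "('o, 'a) cat \<Rightarrow> ('a \<Rightarrow> 'a \<Rightarrow> 'a) \<Rightarrow> bool" where
  "preadditive C add \<longleftrightarrow>
     (\<forall>x\<in>Obj C. \<forall>y\<in>Obj C. \<exists>z. comm_group \<lparr>carrier = Hom C x y, mult = add, one = z\<rparr>) \<and>
     (\<forall>w\<in>Obj C. \<forall>x\<in>Obj C. \<forall>y\<in>Obj C.
        \<forall>f\<in>Hom C w x. \<forall>f'\<in>Hom C w x. \<forall>g\<in>Hom C x y. \<forall>g'\<in>Hom C x y.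
          g \<odot>\<^bsub>C\<^esub> add f f' = add (g \<odot>\<^bsub>C\<^esub> f) (g \<odot>\<^bsub>C\<^esub> f') \<and>
          add g g' \<odot>\<^bsub>C\<^esub> f = add (g \<odot>\<^bsub>C\<^esub> f) (g' \<odot>\<^bsub>C\<^esub> f))"

definition is_biproduct ::
  "('o, 'a) cat \<Rightarrow> ('a \<Rightarrow> 'a \<Rightarrow> 'a) \<Rightarrow> 'o \<Rightarrow> 'o \<Rightarrow> 'o \<Rightarrow> 'a \<Rightarrow> 'a \<Rightarrow> 'a \<Rightarrow> 'a \<Rightarrow> bool" where
  "is_biproduct C add x y b p q i j \<longleftrightarrow>
     b \<in> Obj C \<and> p \<in> Hom C b x \<and> q \<in> Hom C b y \<and> i \<in> Hom C x b \<and> j \<in> Hom C y b \<and>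
     p \<odot>\<^bsub>C\<^esub> i = Idt C x \<and> q \<odot>\<^bsub>C\<^esub> j = Idt C y \<and>
     add (i \<odot>\<^bsub>C\<^esub> p) (j \<odot>\<^bsub>C\<^esub> q) = Idt C b"

text \<open>The additive structure of an abelian category is determined by the category, so being
  abelian is a property and the addition can be quantified existentially.\<close>

definition abelian_category :: "('o, 'a) cat \<Rightarrow> bool" where
  "abelian_category C \<longleftrightarrow> category C \<and>
     (\<exists>add. preadditive C add \<and>
        (\<exists>z. null_object C z) \<and>
        (\<forall>x\<in>Obj C. \<forall>y\<in>Obj C. \<exists>b p q i j. is_biproduct C add x y b p q i j) \<and>
        (\<forall>f\<in>Arr C. \<exists>k. is_kernel C k f) \<and>
        (\<forall>f\<in>Arr C. \<exists>q. is_cokernel C q f) \<and>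
        (\<forall>m. mono_arr C m \<longrightarrow> (\<exists>f. is_kernel C m f)) \<and>
        (\<forall>e. epi_arr C e \<longrightarrow> (\<exists>f. is_cokernel C e f)))"


section \<open>Size\<close>

text \<open>
  The type \<open>'u\<close> plays the role of the universe of all sets, against which size is measured:
  by limitation of size, a collection is a set iff it has strictly fewer elements than the
  universe.  For a Grothendieck universe \<open>U\<close> this is the usual notion, since a collection is in
  bijection with an element of \<open>U\<close> iff its cardinality is strictly below that of \<open>U\<close>.  No closure
  property of \<open>'u\<close> (such as inaccessibility) is imposed: every cardinal bound is allowed.
\<close>

definition small :: "'u itself \<Rightarrow> 'b set \<Rightarrow> bool" where
  "small U X \<longleftrightarrow> X \<prec> (UNIV :: 'u set)"

definition is_cone ::
  "('j, 'k) cat \<Rightarrow> ('o, 'a) cat \<Rightarrow> ('j, 'k, 'o, 'a) ftr \<Rightarrow> 'o \<Rightarrow> ('j \<Rightarrow> 'a) \<Rightarrow> bool" where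
  "is_cone J C F c l \<longleftrightarrow> c \<in> Obj C \<and> (\<forall>j\<in>Obj J. l j \<in> Hom C c (OMap F j)) \<and>
     (\<forall>u\<in>Arr J. AMap F u \<odot>\<^bsub>C\<^esub> l (Dom J u) = l (Cod J u))"

definition is_limit ::
  "('j, 'k) cat \<Rightarrow> ('o, 'a) cat \<Rightarrow> ('j, 'k, 'o, 'a) ftr \<Rightarrow> 'o \<Rightarrow> ('j \<Rightarrow> 'a) \<Rightarrow> bool" where
  "is_limit J C F c l \<longleftrightarrow> is_cone J C F c l \<and>
     (\<forall>c' l'. is_cone J C F c' l' \<longrightarrow>
        (\<exists>!h. h \<in> Hom C c' c \<and> (\<forall>j\<in>Obj J. l j \<odot>\<^bsub>C\<^esub> h = l' j)))"

text \<open>Every small category is isomorphic to one whose objects and arrows are elements of \<open>'u\<close>,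
  so it suffices to let the index category \<open>J\<close> range over those.\<close>

definition complete_category :: "'u itself \<Rightarrow> ('o, 'a) cat \<Rightarrow> bool" where
  "complete_category U C \<longleftrightarrow>
     (\<forall>(J :: ('u, 'u) cat) F. category J \<and> small U (Obj J) \<and> small U (Arr J) \<and> is_ftr J C F \<longrightarrow>
        (\<exists>c l. is_limit J C F c l))"

text \<open>A colimit of \<open>F : J \<rightarrow> C\<close> is a limit of \<open>F : J\<^sup>o\<^sup>p \<rightarrow> C\<^sup>o\<^sup>p\<close>, and \<open>J\<^sup>o\<^sup>p\<close> is small iff \<open>J\<close> is.\<close>

definition cocomplete_category :: "'u itself \<Rightarrow> ('o, 'a) cat \<Rightarrow> bool" where
  "cocomplete_category U C \<longleftrightarrow> complete_category U (op_cat C)"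

definition bicomplete :: "'u itself \<Rightarrow> ('o, 'a) cat \<Rightarrow> bool" where
  "bicomplete U C \<longleftrightarrow> complete_category U C \<and> cocomplete_category U C"

text \<open>This is also called \<open>well-powered\<close>; it is not a condition on the size of hom-sets.\<close>

definition locally_small :: "'u itself \<Rightarrow> ('o, 'a) cat \<Rightarrow> bool" where
  "locally_small U C \<longleftrightarrow> (\<forall>x\<in>Obj C. small U (subobjects C x))"

end

theory Submission
  imports Defs
begin

text \<open>
  Since suprema are infima of upper bounds, it suffices to form the meet of an arbitrary
  collection \<open>M\<close> of preradicals.  At each object \<open>x\<close> the components of \<open>M\<close> represent only a small
  set of subobjects of \<open>x\<close>, whose meet exists by completeness.  These meets are stable under
  every arrow of the category, hence form a subfunctor of the identity.  That the order on
  preradicals is the pointwise one rests on monomorphic transformations being pointwise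
  monomorphic: the pointwise kernels of a transformation form a subfunctor of its source.
\<close>

section \<open>Arrows and subobjects\<close>

text \<open>The obstacle is size. Size is under control only one object at a time, and the data
  found separately at the objects must then be fitted together. They fit because a factorization
  through a monomorphism is unique: this makes a stable family of subobjects functorial and makes
  factorizations found objectwise natural. Such uniqueness can be used at an object only once
  monomorphic transformations have monic components, which fails for general target categories; an
  abelian target supplies it through kernels. Kernels also produce the meets themselves, since in an
  abelian category every monomorphism is one.\<close>

context category
begin

lemma hom_obj:
  assumes "f \<in> Hom C x y"
  shows "x \<in> Obj C" "y \<in> Obj C"
  using assms dom_obj cod_obj by (auto simp: Hom_def)

lemma mono_arrI:
  assumes "m \<in> Hom C x y"
    and "\<And>w f g. \<lbrakk>f \<in> Hom C w x; g \<in> Hom C w x; m \<odot> f = m \<odot> g\<rbrakk> \<Longrightarrow> f = g"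
  shows "mono_arr C m"
  using assms by (auto simp: mono_arr_def Hom_def)

lemma mono_arr_in_Arr: "mono_arr C m \<Longrightarrow> m \<in> Arr C"
  unfolding mono_arr_def by blast

lemma mono_arrD:
  assumes "mono_arr C m" "m \<in> Hom C x y" "f \<in> Hom C w x" "g \<in> Hom C w x" "m \<odot> f = m \<odot> g"
  shows "f = g"
proof -
  have "w \<in> Obj C" "Dom C m = x" using assms hom_obj by (auto simp: Hom_def)
  with assms show ?thesis unfolding mono_arr_def by blast
qed

lemma monos_intoD:
  assumes "m \<in> monos_into C x"
  shows "mono_arr C m" "m \<in> Hom C (Dom C m) x" "Dom C m \<in> Obj C"
  using assms dom_obj by (auto simp: monos_into_def mono_arr_def Hom_def)

lemma factors_throughI:
  assumes "m \<in> Hom C w x" "n \<in> Hom C v x" "h \<in> Hom C w v" "m = n \<odot> h"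
  shows "factors_through C m n"
  using assms by (auto simp: factors_through_def Hom_def)

lemma factors_throughE:
  assumes "factors_through C m n" "m \<in> Hom C w x" "n \<in> Hom C v x"
  obtains h where "h \<in> Hom C w v" "m = n \<odot> h"
  using assms by (auto simp: factors_through_def Hom_def)

lemma factors_through_refl:
  assumes "m \<in> Hom C w x"
  shows "factors_through C m m"
  using assms by (metis factors_throughI cmp_idt_right hom_obj(1) idt_hom)

lemma factors_through_trans:
  assumes "factors_through C m n" "factors_through C n p"
    and m: "m \<in> Hom C w x" and n: "n \<in> Hom C v x" and p: "p \<in> Hom C u x"
  shows "factors_through C m p"
proof -
  obtain h where h: "h \<in> Hom C w v" "m = n \<odot> h" using assms by (elim factors_throughE)
  obtain k where k: "k \<in> Hom C v u" "n = p \<odot> k" using assms by (elim factors_throughE)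
  have "m = p \<odot> (k \<odot> h)" using h k p by (simp add: cmp_assoc)
  then show ?thesis using factors_throughI[OF m p cmp_hom[OF h(1) k(1)]] by simp
qed

lemma factors_through_trans_monos:
  assumes "factors_through C m n" "factors_through C n p"
    and "m \<in> monos_into C x" "n \<in> monos_into C x" "p \<in> monos_into C x"
  shows "factors_through C m p"
  using assms by (meson factors_through_trans monos_intoD(2))

section \<open>Classes of monomorphisms and their order\<close>

lemma equiv_sub_equiv: "equiv (monos_into C x) (sub_equiv C x)"
proof (rule equivI)
  show "sub_equiv C x \<subseteq> monos_into C x \<times> monos_into C x"
    by (auto simp: sub_equiv_def)
  show "refl_on (monos_into C x) (sub_equiv C x)"
    unfolding sub_equiv_def refl_on_def by (auto intro: factors_through_refl[OF monos_intoD(2)])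
  show "sym (sub_equiv C x)" by (auto simp: sub_equiv_def sym_def)
  show "trans (sub_equiv C x)"
    unfolding trans_def sub_equiv_def using factors_through_trans_monos by blast
qed

lemma subobjects_cases:
  assumes "P \<in> subobjects C x"
  obtains m where "m \<in> monos_into C x" "P = sub_equiv C x `` {m}"
  using assms by (auto simp: subobjects_def elim: quotientE)

lemma sub_class_in_subobjects:
  "m \<in> monos_into C x \<Longrightarrow> sub_equiv C x `` {m} \<in> subobjects C x"
  by (simp add: subobjects_def quotientI)

text \<open>The order asks for some pair of representatives. Equivalent monomorphisms factor through
  each other, so transitivity carries a factorization from one pair to any other.\<close>

lemma Sub_le_class_iff:
  assumes m: "m \<in> monos_into C x" and n: "n \<in> monos_into C x"
  shows "sub_equiv C x `` {m} \<sqsubseteq>\<^bsub>Sub C x\<^esub> sub_equiv C x `` {n} \<longleftrightarrow> factors_through C m n"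
proof
  assume "sub_equiv C x `` {m} \<sqsubseteq>\<^bsub>Sub C x\<^esub> sub_equiv C x `` {n}"
  then obtain m' n' where "(m, m') \<in> sub_equiv C x" "(n, n') \<in> sub_equiv C x"
    "factors_through C m' n'"
    by (auto simp: Sub_def)
  then show "factors_through C m n"
    unfolding sub_equiv_def by (blast intro: factors_through_trans_monos)
next
  assume "factors_through C m n"
  moreover have "m \<in> sub_equiv C x `` {m}" "n \<in> sub_equiv C x `` {n}"
    using m n equiv_class_self[OF equiv_sub_equiv] by auto
  ultimately show "sub_equiv C x `` {m} \<sqsubseteq>\<^bsub>Sub C x\<^esub> sub_equiv C x `` {n}"
    by (auto simp: Sub_def)
qed

lemma partial_order_Sub: "partial_order (Sub C x)"
proof
  fix P Q R
  assume P: "P \<in> carrier (Sub C x)" and Q: "Q \<in> carrier (Sub C x)"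
  from P obtain m where m: "m \<in> monos_into C x" "P = sub_equiv C x `` {m}"
    by (auto simp: Sub_def elim: subobjects_cases)
  from Q obtain n where n: "n \<in> monos_into C x" "Q = sub_equiv C x `` {n}"
    by (auto simp: Sub_def elim: subobjects_cases)
  show "P \<sqsubseteq>\<^bsub>Sub C x\<^esub> P"
    using m factors_through_refl[OF monos_intoD(2)[OF m(1)]] by (simp add: Sub_le_class_iff)
  {
    assume "P \<sqsubseteq>\<^bsub>Sub C x\<^esub> Q" "Q \<sqsubseteq>\<^bsub>Sub C x\<^esub> P"
    then have "(m, n) \<in> sub_equiv C x"
      using m n Sub_le_class_iff by (simp add: sub_equiv_def)
    then show "P .=\<^bsub>Sub C x\<^esub> Q"
      using m n equiv_class_eq[OF equiv_sub_equiv] by (simp add: Sub_def)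
  }
  {
    assume le: "P \<sqsubseteq>\<^bsub>Sub C x\<^esub> Q" "Q \<sqsubseteq>\<^bsub>Sub C x\<^esub> R" and R: "R \<in> carrier (Sub C x)"
    from R obtain p where p: "p \<in> monos_into C x" "R = sub_equiv C x `` {p}"
      by (auto simp: Sub_def elim: subobjects_cases)
    show "P \<sqsubseteq>\<^bsub>Sub C x\<^esub> R"
      using le m n p Sub_le_class_iff factors_through_trans_monos by metis
  }
qed (auto simp: Sub_def)

text \<open>The last clause tests against all arrows into \<open>x\<close>, not only monomorphisms:
  in the proof that the meets are stable under \<open>f\<close> it is applied to
  \<open>f \<odot> k x\<close>, which need not be monic.\<close>

definition is_meet :: "'a set \<Rightarrow> 'o \<Rightarrow> 'a \<Rightarrow> bool" where
  "is_meet M x k \<longleftrightarrow> k \<in> monos_into C x \<and> (\<forall>m\<in>M. factors_through C k m) \<and>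
     (\<forall>w. \<forall>g\<in>Hom C w x. (\<forall>m\<in>M. factors_through C g m) \<longrightarrow> factors_through C g k)"

text \<open>This moves the search for infima from classes to monomorphisms. By the equivalence in
  the premise, the lower bounds are exactly the classes below that of \<open>k\<close>.
  \<open>M\<close> has no size bound, as the application to a functor category demands.\<close>

lemma complete_lattice_SubI:
  assumes meet: "\<And>M. M \<subseteq> monos_into C x \<Longrightarrow>
    \<exists>k\<in>monos_into C x. \<forall>g\<in>monos_into C x.
      factors_through C g k \<longleftrightarrow> (\<forall>m\<in>M. factors_through C g m)"
  shows "complete_lattice (Sub C x)"
proof -
  interpret L: partial_order "Sub C x" by (rule partial_order_Sub)
  have carr: "carrier (Sub C x) = subobjects C x" by (simp add: Sub_def)
  have inf: "\<exists>i. greatest (Sub C x) i (Lower (Sub C x) A)" if A: "A \<subseteq> carrier (Sub C x)" for A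
  proof -
    \<comment> \<open>Collecting every monomorphism whose class lies in \<open>A\<close>, rather
      than one per class, avoids a choice; \<open>meet\<close> accepts sets of any size.\<close>
    let ?M = "{m \<in> monos_into C x. sub_equiv C x `` {m} \<in> A}"
    obtain k where k: "k \<in> monos_into C x"
      and iff: "\<And>g. g \<in> monos_into C x \<Longrightarrow>
        factors_through C g k \<longleftrightarrow> (\<forall>m\<in>?M. factors_through C g m)"
      using meet[of ?M] by blast
    have Lower: "sub_equiv C x `` {g} \<in> Lower (Sub C x) A \<longleftrightarrow> factors_through C g k"
      if g: "g \<in> monos_into C x" for g
    proof -
      have "sub_equiv C x `` {g} \<in> Lower (Sub C x) A \<longleftrightarrow>
          (\<forall>P\<in>A. sub_equiv C x `` {g} \<sqsubseteq>\<^bsub>Sub C x\<^esub> P)"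
        using A g sub_class_in_subobjects carr by (auto simp: Lower_def)
      also have "\<dots> \<longleftrightarrow> (\<forall>m\<in>?M. factors_through C g m)"
      proof (intro iffI ballI)
        fix P assume fac: "\<forall>m\<in>?M. factors_through C g m" and P: "P \<in> A"
        then have "P \<in> subobjects C x" using A carr by auto
        then obtain m where "m \<in> monos_into C x" "P = sub_equiv C x `` {m}"
          by (rule subobjects_cases)
        then show "sub_equiv C x `` {g} \<sqsubseteq>\<^bsub>Sub C x\<^esub> P"
          using fac P Sub_le_class_iff[OF g] by simp
      qed (use Sub_le_class_iff[OF g] in blast)
      finally show ?thesis using iff[OF g] by simp
    qed
    have "greatest (Sub C x) (sub_equiv C x `` {k}) (Lower (Sub C x) A)"
      unfolding greatest_def
    proof (intro conjI ballI)
      show "sub_equiv C x `` {k} \<in> Lower (Sub C x) A"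
        using Lower[OF k] k factors_through_refl monos_intoD(2) by blast
      fix P assume P: "P \<in> Lower (Sub C x) A"
      then have "P \<in> subobjects C x" by (auto simp: Lower_def carr)
      then obtain g where "g \<in> monos_into C x" "P = sub_equiv C x `` {g}"
        by (rule subobjects_cases)
      with P k show "P \<sqsubseteq>\<^bsub>Sub C x\<^esub> sub_equiv C x `` {k}"
        by (simp add: Lower Sub_le_class_iff)
    qed (auto simp: Lower_def)
    then show ?thesis ..
  qed
  show ?thesis
  proof (rule L.complete_lattice_criterion1)
    \<comment> \<open>The criterion asks for a top element besides infima of nonempty sets; it is
      the infimum of the empty set.\<close>
    show "\<exists>g. greatest (Sub C x) g (carrier (Sub C x))"
      using inf[of "{}"] by (simp add: Lower_def)
  qed (use inf in blast)
qed

end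


section \<open>Functor categories and subfunctors\<close>

lemma is_ftrD:
  assumes "is_ftr C D F"
  shows "x \<in> Obj C \<Longrightarrow> OMap F x \<in> Obj D"
    and "f \<in> Hom C x y \<Longrightarrow> category C \<Longrightarrow> AMap F f \<in> Hom D (OMap F x) (OMap F y)"
    and "x \<in> Obj C \<Longrightarrow> AMap F (Idt C x) = Idt D (OMap F x)"
    and "f \<in> Hom C x y \<Longrightarrow> g \<in> Hom C y z \<Longrightarrow>
      AMap F (g \<odot>\<^bsub>C\<^esub> f) = AMap F g \<odot>\<^bsub>D\<^esub> AMap F f"
proof -
  show "AMap F f \<in> Hom D (OMap F x) (OMap F y)" if "f \<in> Hom C x y" "category C"
    using assms that category.hom_obj[OF that(2,1)] by (auto simp: is_ftr_def)
qed (use assms in \<open>auto simp: is_ftr_def Hom_def\<close>)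

lemma is_ntrD:
  assumes "is_ntr C D t"
  shows "is_ftr C D (Src t)" "is_ftr C D (Trg t)"
    and "x \<in> Obj C \<Longrightarrow> At t x \<in> Hom D (OMap (Src t) x) (OMap (Trg t) x)"
    and "f \<in> Hom C x y \<Longrightarrow> At t y \<odot>\<^bsub>D\<^esub> AMap (Src t) f = AMap (Trg t) f \<odot>\<^bsub>D\<^esub> At t x"
    and "At t \<in> extensional (Obj C)"
  using assms by (auto simp: is_ntr_def Hom_def PiE_def Pi_def)

lemma ntr_eqI:
  assumes "is_ntr C D s" "is_ntr C D t" "Src s = Src t" "Trg s = Trg t"
    and "\<And>x. x \<in> Obj C \<Longrightarrow> At s x = At t x"
  shows "s = (t :: ('o, 'a, 'p, 'b) ntr)"
proof -
  have "At s = At t" using assms is_ntrD(5) by (metis extensionalityI)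
  with assms show ?thesis by simp
qed

lemma Hom_Fun_cat_iff:
  "t \<in> Hom (Fun_cat C D) F G \<longleftrightarrow> is_ntr C D t \<and> Src t = F \<and> Trg t = G"
  by (simp add: Hom_def Fun_cat_def)

lemma Fun_cat_simps [simp]:
  "Obj (Fun_cat C D) = {F. is_ftr C D F}" "Arr (Fun_cat C D) = {t. is_ntr C D t}"
  "Dom (Fun_cat C D) = Src" "Cod (Fun_cat C D) = Trg"
  by (simp_all add: Fun_cat_def)

lemma At_Cmp_Fun_cat:
  "x \<in> Obj C \<Longrightarrow> At (s \<odot>\<^bsub>Fun_cat C D\<^esub> t) x = At s x \<odot>\<^bsub>D\<^esub> At t x"
  by (simp add: Fun_cat_def)

lemma (in category) is_ftr_id_ftr: "is_ftr C C (id_ftr C)"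
  unfolding is_ftr_def id_ftr_def
proof (intro conjI ballI impI)
  fix f g assume "f \<in> Arr C" "g \<in> Arr C" "Cod C f = Dom C g"
  then have "g \<odot> f \<in> Hom C (Dom C f) (Cod C g)" by (intro cmp_hom) (auto simp: Hom_def)
  with \<open>f \<in> Arr C\<close> \<open>g \<in> Arr C\<close>
  show "AMap \<lparr>OMap = restrict (\<lambda>x. x) (Obj C), AMap = restrict (\<lambda>f. f) (Arr C)\<rparr> (g \<odot> f) =
      AMap \<lparr>OMap = restrict (\<lambda>x. x) (Obj C), AMap = restrict (\<lambda>f. f) (Arr C)\<rparr> g \<odot>
      AMap \<lparr>OMap = restrict (\<lambda>x. x) (Obj C), AMap = restrict (\<lambda>f. f) (Arr C)\<rparr> f"
    by (simp add: Hom_def)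
qed (use idt_hom in \<open>auto simp: Hom_def\<close>)

section \<open>Transformations and factorizations handled objectwise\<close>

locale two_categories = C: category C + D: category D
  for C :: "('o, 'a) cat" and D :: "('p, 'b) cat"
begin

lemma is_ntrI:
  assumes "is_ftr C D F" "is_ftr C D G"
    and "\<And>x. x \<in> Obj C \<Longrightarrow> \<alpha> x \<in> Hom D (OMap F x) (OMap G x)"
    and "\<And>f x y. f \<in> Hom C x y \<Longrightarrow> \<alpha> y \<odot>\<^bsub>D\<^esub> AMap F f = AMap G f \<odot>\<^bsub>D\<^esub> \<alpha> x"
  shows "is_ntr C D \<lparr>Src = F, Trg = G, At = restrict \<alpha> (Obj C)\<rparr>"
  using assms by (auto simp: is_ntr_def Hom_def C.dom_obj C.cod_obj)

lemma category_Fun_cat: "category (Fun_cat C D)"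
proof
  show "Idt (Fun_cat C D) F \<in> Hom (Fun_cat C D) F F" if "F \<in> Obj (Fun_cat C D)" for F
  proof -
    have F: "is_ftr C D F" using that by (simp add: Fun_cat_def)
    have "is_ntr C D \<lparr>Src = F, Trg = F, At = restrict (\<lambda>x. Idt D (OMap F x)) (Obj C)\<rparr>"
      using F D.idt_hom is_ftrD(1,2)[OF F] C.category_axioms D.cmp_idt_left D.cmp_idt_right
      by (intro is_ntrI) metis+
    then show ?thesis by (simp add: Hom_Fun_cat_iff) (simp add: Fun_cat_def)
  qed
  show cmp: "s \<odot>\<^bsub>Fun_cat C D\<^esub> t \<in> Hom (Fun_cat C D) F H"
    if "t \<in> Hom (Fun_cat C D) F G" "s \<in> Hom (Fun_cat C D) G H" for s t F G H
  proof -
    have t: "is_ntr C D t" "Src t = F" "Trg t = G" and s: "is_ntr C D s" "Src s = G" "Trg s = H"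
      using that by (auto simp: Hom_Fun_cat_iff)
    have "is_ntr C D \<lparr>Src = F, Trg = H, At = restrict (\<lambda>x. At s x \<odot>\<^bsub>D\<^esub> At t x) (Obj C)\<rparr>"
    proof (rule is_ntrI)
      show "is_ftr C D F" "is_ftr C D H" using s t is_ntrD by auto
      show "At s x \<odot>\<^bsub>D\<^esub> At t x \<in> Hom D (OMap F x) (OMap H x)" if "x \<in> Obj C" for x
        using that s t is_ntrD(3) D.cmp_hom by metis
      fix f x y assume f: "f \<in> Hom C x y"
      note xy = C.hom_obj[OF f]
      have h: "At t x \<in> Hom D (OMap F x) (OMap G x)" "At t y \<in> Hom D (OMap F y) (OMap G y)"
        "At s x \<in> Hom D (OMap G x) (OMap H x)" "At s y \<in> Hom D (OMap G y) (OMap H y)"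
        using is_ntrD(3)[OF t(1)] is_ntrD(3)[OF s(1)] xy s t by auto
      have F: "AMap F f \<in> Hom D (OMap F x) (OMap F y)" "AMap G f \<in> Hom D (OMap G x) (OMap G y)"
          "AMap H f \<in> Hom D (OMap H x) (OMap H y)"
        using s t f is_ntrD(1,2) is_ftrD(2) C.category_axioms by metis+
      have "(At s y \<odot>\<^bsub>D\<^esub> At t y) \<odot>\<^bsub>D\<^esub> AMap F f = At s y \<odot>\<^bsub>D\<^esub> (AMap G f \<odot>\<^bsub>D\<^esub> At t x)"
        using D.cmp_assoc[OF F(1) h(2,4)] is_ntrD(4)[OF t(1) f] t by simp
      also have "\<dots> = (AMap H f \<odot>\<^bsub>D\<^esub> At s x) \<odot>\<^bsub>D\<^esub> At t x"
        using D.cmp_assoc[OF h(1) F(2) h(4)] is_ntrD(4)[OF s(1) f] s by simp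
      also have "\<dots> = AMap H f \<odot>\<^bsub>D\<^esub> (At s x \<odot>\<^bsub>D\<^esub> At t x)"
        by (rule D.cmp_assoc[OF h(1,3) F(3)])
      finally show "(At s y \<odot>\<^bsub>D\<^esub> At t y) \<odot>\<^bsub>D\<^esub> AMap F f = AMap H f \<odot>\<^bsub>D\<^esub> (At s x \<odot>\<^bsub>D\<^esub> At t x)" .
    qed
    then show ?thesis using s t by (simp add: Hom_Fun_cat_iff) (simp add: Fun_cat_def)
  qed
  have idt: "Idt (Fun_cat C D) F \<in> Hom (Fun_cat C D) F F" if "is_ftr C D F" for F
    using \<open>\<And>F. F \<in> Obj (Fun_cat C D) \<Longrightarrow> Idt (Fun_cat C D) F \<in> Hom (Fun_cat C D) F F\<close> that
    by (simp add: Fun_cat_def)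
  have AtI: "x \<in> Obj C \<Longrightarrow> At (Idt (Fun_cat C D) F) x = Idt D (OMap F x)" for F x
    by (simp add: Fun_cat_def)
  fix t F G assume tH: "t \<in> Hom (Fun_cat C D) F G"
  then have t: "is_ntr C D t" "Src t = F" "Trg t = G" by (auto simp: Hom_Fun_cat_iff)
  have F: "is_ftr C D F" "is_ftr C D G" using t is_ntrD(1,2) by auto
  have h: "x \<in> Obj C \<Longrightarrow> At t x \<in> Hom D (OMap F x) (OMap G x)" for x
    using is_ntrD(3)[OF t(1)] t by simp
  show "Idt (Fun_cat C D) G \<odot>\<^bsub>Fun_cat C D\<^esub> t = t"
    using cmp[OF tH idt[OF F(2)]] t h
    by (intro ntr_eqI[of C D]) (auto simp: Hom_Fun_cat_iff At_Cmp_Fun_cat AtI intro: D.cmp_idt_left)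
  show "t \<odot>\<^bsub>Fun_cat C D\<^esub> Idt (Fun_cat C D) F = t"
    using cmp[OF idt[OF F(1)] tH] t h
    by (intro ntr_eqI[of C D]) (auto simp: Hom_Fun_cat_iff At_Cmp_Fun_cat AtI intro: D.cmp_idt_right)
  fix s H r K assume sH: "s \<in> Hom (Fun_cat C D) G H" and rH: "r \<in> Hom (Fun_cat C D) H K"
  then have s: "is_ntr C D s" "Src s = G" "Trg s = H" and r: "is_ntr C D r" "Src r = H" "Trg r = K"
    by (auto simp: Hom_Fun_cat_iff)
  have "(r \<odot>\<^bsub>Fun_cat C D\<^esub> s) \<odot>\<^bsub>Fun_cat C D\<^esub> t \<in> Hom (Fun_cat C D) F K"
    "r \<odot>\<^bsub>Fun_cat C D\<^esub> (s \<odot>\<^bsub>Fun_cat C D\<^esub> t) \<in> Hom (Fun_cat C D) F K"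
    using cmp tH sH rH by blast+
  then show "(r \<odot>\<^bsub>Fun_cat C D\<^esub> s) \<odot>\<^bsub>Fun_cat C D\<^esub> t = r \<odot>\<^bsub>Fun_cat C D\<^esub> (s \<odot>\<^bsub>Fun_cat C D\<^esub> t)"
    using is_ntrD(3)[OF t(1)] is_ntrD(3)[OF s(1)] is_ntrD(3)[OF r(1)] s t r
    by (intro ntr_eqI[of C D]) (auto simp: Hom_Fun_cat_iff At_Cmp_Fun_cat intro: D.cmp_assoc)
qed (auto simp: Fun_cat_def dest: is_ntrD)

lemma pointwise_mono_imp_mono:
  assumes t: "is_ntr C D t" and mono: "\<And>x. x \<in> Obj C \<Longrightarrow> mono_arr D (At t x)"
  shows "mono_arr (Fun_cat C D) t"
proof -
  interpret Fun: category "Fun_cat C D" by (rule category_Fun_cat)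
  show ?thesis
  proof (rule Fun.mono_arrI)
    show "t \<in> Hom (Fun_cat C D) (Src t) (Trg t)" using t by (simp add: Hom_Fun_cat_iff)
    fix H r s
    assume "r \<in> Hom (Fun_cat C D) H (Src t)" "s \<in> Hom (Fun_cat C D) H (Src t)"
      and eq: "t \<odot>\<^bsub>Fun_cat C D\<^esub> r = t \<odot>\<^bsub>Fun_cat C D\<^esub> s"
    then have r: "is_ntr C D r" "Src r = H" "Trg r = Src t"
      and s: "is_ntr C D s" "Src s = H" "Trg s = Src t" by (auto simp: Hom_Fun_cat_iff)
    show "r = s"
    proof (rule ntr_eqI[OF r(1) s(1)])
      fix x assume x: "x \<in> Obj C"
      show "At r x = At s x"
      proof (rule D.mono_arrD[OF mono[OF x] is_ntrD(3)[OF t x]])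
        show "At r x \<in> Hom D (OMap H x) (OMap (Src t) x)" using is_ntrD(3)[OF r(1) x] r by simp
        show "At s x \<in> Hom D (OMap H x) (OMap (Src t) x)" using is_ntrD(3)[OF s(1) x] s by simp
        show "At t x \<odot>\<^bsub>D\<^esub> At r x = At t x \<odot>\<^bsub>D\<^esub> At s x"
          using eq x by (metis At_Cmp_Fun_cat)
      qed
    qed (use r s in auto)
  qed
qed

lemma factors_through_pointwise:
  assumes s: "is_ntr C D s" and t: "is_ntr C D t" and "Trg s = Trg t"
    and f: "factors_through (Fun_cat C D) s t" and x: "x \<in> Obj C"
  shows "factors_through D (At s x) (At t x)"
proof -
  obtain h where h: "is_ntr C D h" "Src h = Src s" "Trg h = Src t" "s = t \<odot>\<^bsub>Fun_cat C D\<^esub> h"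
    using f unfolding factors_through_def Hom_Fun_cat_iff Bex_def Fun_cat_simps by blast
  show ?thesis
  proof (rule D.factors_throughI)
    show "At s x \<in> Hom D (OMap (Src s) x) (OMap (Trg t) x)"
      using is_ntrD(3)[OF s x] assms by simp
    show "At t x \<in> Hom D (OMap (Src t) x) (OMap (Trg t) x)" by (rule is_ntrD(3)[OF t x])
    show "At h x \<in> Hom D (OMap (Src s) x) (OMap (Src t) x)" using is_ntrD(3)[OF h(1) x] h by simp
    show "At s x = At t x \<odot>\<^bsub>D\<^esub> At h x" using h(4) x by (metis At_Cmp_Fun_cat)
  qed
qed

text \<open>The arrows \<open>\<eta> x\<close> are chosen independently, yet they are natural: both
  sides of the naturality square agree after composition with the monomorphism
  \<open>At t y\<close>, by naturality of \<open>s\<close> and \<open>t\<close>.\<close>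

lemma pointwise_factors_through:
  assumes s: "is_ntr C D s" and t: "is_ntr C D t" and Trg: "Trg s = Trg t"
    and mono: "\<And>x. x \<in> Obj C \<Longrightarrow> mono_arr D (At t x)"
    and fac: "\<And>x. x \<in> Obj C \<Longrightarrow> factors_through D (At s x) (At t x)"
  shows "factors_through (Fun_cat C D) s t"
proof -
  have sx: "At s x \<in> Hom D (OMap (Src s) x) (OMap (Trg t) x)"
    and tx: "At t x \<in> Hom D (OMap (Src t) x) (OMap (Trg t) x)" if "x \<in> Obj C" for x
    using is_ntrD(3)[OF s that] is_ntrD(3)[OF t that] Trg by auto
  have "\<forall>x\<in>Obj C. \<exists>h. h \<in> Hom D (OMap (Src s) x) (OMap (Src t) x) \<and> At s x = At t x \<odot>\<^bsub>D\<^esub> h"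
    using D.factors_throughE[OF fac sx tx] by metis
  then obtain \<eta> where \<eta>: "\<And>x. x \<in> Obj C \<Longrightarrow> \<eta> x \<in> Hom D (OMap (Src s) x) (OMap (Src t) x)"
    and eq: "\<And>x. x \<in> Obj C \<Longrightarrow> At s x = At t x \<odot>\<^bsub>D\<^esub> \<eta> x" by metis
  define h where "h = \<lparr>Src = Src s, Trg = Src t, At = restrict \<eta> (Obj C)\<rparr>"
  have "is_ntr C D h" unfolding h_def
  proof (rule is_ntrI)
    show S: "is_ftr C D (Src s)" and T: "is_ftr C D (Src t)" using s t is_ntrD by auto
    fix f x y assume f: "f \<in> Hom C x y"
    note xy = C.hom_obj[OF f]
    have Sf: "AMap (Src s) f \<in> Hom D (OMap (Src s) x) (OMap (Src s) y)"
      and Tf: "AMap (Src t) f \<in> Hom D (OMap (Src t) x) (OMap (Src t) y)"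
      and Gf: "AMap (Trg t) f \<in> Hom D (OMap (Trg t) x) (OMap (Trg t) y)"
      using f S T is_ntrD(2)[OF t] is_ftrD(2) C.category_axioms by metis+
    show "\<eta> y \<odot>\<^bsub>D\<^esub> AMap (Src s) f = AMap (Src t) f \<odot>\<^bsub>D\<^esub> \<eta> x"
    proof (rule D.mono_arrD[OF mono[OF xy(2)] tx[OF xy(2)]])
      have "At t y \<odot>\<^bsub>D\<^esub> (\<eta> y \<odot>\<^bsub>D\<^esub> AMap (Src s) f) = At s y \<odot>\<^bsub>D\<^esub> AMap (Src s) f"
        using D.cmp_assoc[OF Sf \<eta>[OF xy(2)] tx[OF xy(2)]] eq[OF xy(2)] by simp
      also have "\<dots> = AMap (Trg t) f \<odot>\<^bsub>D\<^esub> (At t x \<odot>\<^bsub>D\<^esub> \<eta> x)"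
        using is_ntrD(4)[OF s f] eq[OF xy(1)] Trg by simp
      also have "\<dots> = (At t y \<odot>\<^bsub>D\<^esub> AMap (Src t) f) \<odot>\<^bsub>D\<^esub> \<eta> x"
        using D.cmp_assoc[OF \<eta>[OF xy(1)] tx[OF xy(1)] Gf] is_ntrD(4)[OF t f] by simp
      also have "\<dots> = At t y \<odot>\<^bsub>D\<^esub> (AMap (Src t) f \<odot>\<^bsub>D\<^esub> \<eta> x)"
        by (rule D.cmp_assoc[OF \<eta>[OF xy(1)] Tf tx[OF xy(2)]])
      finally show "At t y \<odot>\<^bsub>D\<^esub> (\<eta> y \<odot>\<^bsub>D\<^esub> AMap (Src s) f) =
        At t y \<odot>\<^bsub>D\<^esub> (AMap (Src t) f \<odot>\<^bsub>D\<^esub> \<eta> x)" .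
    qed (use D.cmp_hom Sf Tf \<eta> xy in blast)+
  qed (use \<eta> in auto)
  then have h: "h \<in> Hom (Fun_cat C D) (Src s) (Src t)" by (simp add: Hom_Fun_cat_iff h_def)
  interpret Fun: category "Fun_cat C D" by (rule category_Fun_cat)
  have sH: "s \<in> Hom (Fun_cat C D) (Src s) (Trg t)" and tH: "t \<in> Hom (Fun_cat C D) (Src t) (Trg t)"
    using s t Trg by (auto simp: Hom_Fun_cat_iff)
  have "s = t \<odot>\<^bsub>Fun_cat C D\<^esub> h"
  proof (rule ntr_eqI[OF s])
    show "is_ntr C D (t \<odot>\<^bsub>Fun_cat C D\<^esub> h)" "Src s = Src (t \<odot>\<^bsub>Fun_cat C D\<^esub> h)"
      "Trg s = Trg (t \<odot>\<^bsub>Fun_cat C D\<^esub> h)"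
      using Fun.cmp_hom[OF h tH] Trg by (auto simp: Hom_Fun_cat_iff)
  qed (simp add: At_Cmp_Fun_cat eq h_def)
  then show ?thesis using Fun.factors_throughI[OF sH tH h] by simp
qed

text \<open>Stability gives a restriction of each \<open>AMap F f\<close> to the chosen subobjects.
  As the \<open>k x\<close> are monic, restrictions are unique, so they respect identities and
  composites; the equation that defines them is naturality of \<open>k\<close>.\<close>

lemma subfunctor_exists:
  assumes F: "is_ftr C D F"
    and k: "\<And>x. x \<in> Obj C \<Longrightarrow> k x \<in> monos_into D (OMap F x)"
    and stable: "\<And>f x y. f \<in> Hom C x y \<Longrightarrow> factors_through D (AMap F f \<odot>\<^bsub>D\<^esub> k x) (k y)"
  shows "\<exists>t. is_ntr C D t \<and> Trg t = F \<and> (\<forall>x\<in>Obj C. At t x = k x)"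
proof -
  define T where "T x = Dom D (k x)" for x
  have kx: "mono_arr D (k x)" "k x \<in> Hom D (T x) (OMap F x)" "T x \<in> Obj D" if "x \<in> Obj C" for x
    using D.monos_intoD[OF k[OF that]] by (auto simp: T_def)
  have Ff: "AMap F f \<in> Hom D (OMap F x) (OMap F y)" if "f \<in> Hom C x y" for f x y
    using is_ftrD(2)[OF F that C.category_axioms] .
  have "\<exists>u. u \<in> Hom D (T x) (T y) \<and> AMap F f \<odot>\<^bsub>D\<^esub> k x = k y \<odot>\<^bsub>D\<^esub> u" if f: "f \<in> Hom C x y" for f x y
    using D.factors_throughE[OF stable[OF f] D.cmp_hom[OF kx(2) Ff[OF f]] kx(2)] C.hom_obj[OF f]
    by metis
  \<comment> \<open>Restating existence with \<open>Dom C f\<close> and \<open>Cod C f\<close> lets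
    the chosen restriction depend on \<open>f\<close> alone, as the arrow map of a functor
    must.\<close>
  then have "\<exists>u. u \<in> Hom D (T (Dom C f)) (T (Cod C f)) \<and>
      AMap F f \<odot>\<^bsub>D\<^esub> k (Dom C f) = k (Cod C f) \<odot>\<^bsub>D\<^esub> u" if "f \<in> Arr C" for f
    using that by (simp add: Hom_def)
  then obtain u where u': "\<And>f. f \<in> Arr C \<Longrightarrow> u f \<in> Hom D (T (Dom C f)) (T (Cod C f)) \<and>
      AMap F f \<odot>\<^bsub>D\<^esub> k (Dom C f) = k (Cod C f) \<odot>\<^bsub>D\<^esub> u f" by metis
  have u: "u f \<in> Hom D (T x) (T y)" and eq: "AMap F f \<odot>\<^bsub>D\<^esub> k x = k y \<odot>\<^bsub>D\<^esub> u f"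
    if "f \<in> Hom C x y" for f x y
    using u'[of f] that by (auto simp: Hom_def)
  define S where "S = \<lparr>OMap = restrict T (Obj C), AMap = restrict u (Arr C)\<rparr>"
  have u_idt: "u (Idt C x) = Idt D (T x)" if x: "x \<in> Obj C" for x
  proof (rule D.mono_arrD[OF kx(1,2)[OF x]])
    show "k x \<odot>\<^bsub>D\<^esub> u (Idt C x) = k x \<odot>\<^bsub>D\<^esub> Idt D (T x)"
      using eq[OF C.idt_hom[OF x]] is_ftrD(3)[OF F x] D.cmp_idt_left[OF kx(2)[OF x]]
        D.cmp_idt_right[OF kx(2)[OF x]] by simp
  qed (use u C.idt_hom D.idt_hom kx x in auto)
  have u_cmp: "u (g \<odot>\<^bsub>C\<^esub> f) = u g \<odot>\<^bsub>D\<^esub> u f" if f: "f \<in> Hom C x y" and g: "g \<in> Hom C y z" for f g x y z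
  proof -
    have o: "x \<in> Obj C" "y \<in> Obj C" "z \<in> Obj C" using C.hom_obj f g by auto
    note gf = C.cmp_hom[OF f g]
    show ?thesis
    proof (rule D.mono_arrD[OF kx(1,2)[OF o(3)]])
      have "k z \<odot>\<^bsub>D\<^esub> u (g \<odot>\<^bsub>C\<^esub> f) = AMap F g \<odot>\<^bsub>D\<^esub> (AMap F f \<odot>\<^bsub>D\<^esub> k x)"
        using eq[OF gf] is_ftrD(4)[OF F f g] D.cmp_assoc[OF kx(2)[OF o(1)] Ff[OF f] Ff[OF g]] by simp
      also have "\<dots> = (AMap F g \<odot>\<^bsub>D\<^esub> k y) \<odot>\<^bsub>D\<^esub> u f"
        using eq[OF f] D.cmp_assoc[OF u[OF f] kx(2)[OF o(2)] Ff[OF g]] by simp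
      also have "\<dots> = k z \<odot>\<^bsub>D\<^esub> (u g \<odot>\<^bsub>D\<^esub> u f)"
        using eq[OF g] D.cmp_assoc[OF u[OF f] u[OF g] kx(2)[OF o(3)]] by simp
      finally show "k z \<odot>\<^bsub>D\<^esub> u (g \<odot>\<^bsub>C\<^esub> f) = k z \<odot>\<^bsub>D\<^esub> (u g \<odot>\<^bsub>D\<^esub> u f)" .
    qed (use u gf f g D.cmp_hom in blast)+
  qed
  have S: "is_ftr C D S"
    unfolding is_ftr_def
  proof (intro conjI ballI impI)
    show "OMap S \<in> Obj C \<rightarrow>\<^sub>E Obj D" using kx(3) by (auto simp: S_def)
    show "AMap S \<in> Arr C \<rightarrow>\<^sub>E Arr D" using u' by (auto simp: S_def Hom_def)
    show "AMap S f \<in> Hom D (OMap S x) (OMap S y)" if "x \<in> Obj C" "y \<in> Obj C" "f \<in> Hom C x y" for f x y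
      using that u[OF that(3)] by (simp add: S_def Hom_def)
    show "AMap S (Idt C x) = Idt D (OMap S x)" if "x \<in> Obj C" for x
      using that C.idt_hom[OF that] u_idt by (simp add: S_def Hom_def)
    fix f g assume fg: "f \<in> Arr C" "g \<in> Arr C" "Cod C f = Dom C g"
    then have *: "f \<in> Hom C (Dom C f) (Dom C g)" "g \<in> Hom C (Dom C g) (Cod C g)"
      by (auto simp: Hom_def)
    show "AMap S (g \<odot>\<^bsub>C\<^esub> f) = AMap S g \<odot>\<^bsub>D\<^esub> AMap S f"
      using fg u_cmp[OF *] C.cmp_hom[OF *] by (simp add: S_def Hom_def)
  qed
  have "is_ntr C D \<lparr>Src = S, Trg = F, At = restrict k (Obj C)\<rparr>"
  proof (rule is_ntrI[OF S F])
    show "k x \<in> Hom D (OMap S x) (OMap F x)" if "x \<in> Obj C" for x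
      using kx(2)[OF that] that by (simp add: S_def)
    show "k y \<odot>\<^bsub>D\<^esub> AMap S f = AMap F f \<odot>\<^bsub>D\<^esub> k x" if "f \<in> Hom C x y" for f x y
      using eq[OF that] that by (simp add: S_def Hom_def)
  qed
  then show ?thesis by (metis (lifting) ntr.select_convs(2,3) restrict_apply')
qed

end


section \<open>Zero arrows and kernels\<close>

context category
begin

lemma null_object_uniqueD:
  assumes "null_object C z" "x \<in> Obj C"
  shows "f \<in> Hom C x z \<Longrightarrow> g \<in> Hom C x z \<Longrightarrow> f = g"
    and "f \<in> Hom C z x \<Longrightarrow> g \<in> Hom C z x \<Longrightarrow> f = g"
  using assms unfolding null_object_def by blast+

lemma zero_arrE:
  assumes "zero_arr C f" "f \<in> Hom C x y"
  obtains z g h where "null_object C z" "g \<in> Hom C x z" "h \<in> Hom C z y" "f = h \<odot> g"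
  using assms by (auto simp: zero_arr_def Hom_def)

lemma zero_arrI:
  assumes "null_object C z" "g \<in> Hom C x z" "h \<in> Hom C z y"
  shows "zero_arr C (h \<odot> g)"
proof -
  have "h \<odot> g \<in> Arr C" "Dom C (h \<odot> g) = x" "Cod C (h \<odot> g) = y"
    using cmp_hom[OF assms(2,3)] by (auto simp: Hom_def)
  with assms show ?thesis unfolding zero_arr_def by blast
qed

lemma zero_arr_cmp_left:
  assumes "zero_arr C f" and f: "f \<in> Hom C x y" and g: "g \<in> Hom C y w"
  shows "zero_arr C (g \<odot> f)"
proof -
  obtain z a b where "null_object C z" "a \<in> Hom C x z" "b \<in> Hom C z y" "f = b \<odot> a"
    using assms(1) f by (rule zero_arrE)
  then show ?thesis using zero_arrI cmp_hom[OF _ g] cmp_assoc[OF _ _ g] by metis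
qed

lemma zero_arr_cmp_right:
  assumes "zero_arr C g" and g: "g \<in> Hom C y w" and f: "f \<in> Hom C x y"
  shows "zero_arr C (g \<odot> f)"
proof -
  obtain z a b where "null_object C z" "a \<in> Hom C y z" "b \<in> Hom C z w" "g = b \<odot> a"
    using assms(1) g by (rule zero_arrE)
  then show ?thesis using zero_arrI cmp_hom[OF f] cmp_assoc[OF f] by metis
qed

text \<open>The two arrows may pass through different null objects. The unique arrow
  \<open>u\<close> between these objects turns one factorization into the other.\<close>

lemma zero_arr_unique:
  assumes "zero_arr C f" "zero_arr C g" and fg: "f \<in> Hom C x y" "g \<in> Hom C x y"
  shows "f = g"
proof -
  note o = hom_obj[OF fg(1)]
  obtain z a b where z: "null_object C z" "a \<in> Hom C x z" "b \<in> Hom C z y" "f = b \<odot> a"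
    using assms(1) fg(1) by (rule zero_arrE)
  obtain z' a' b' where z': "null_object C z'" "a' \<in> Hom C x z'" "b' \<in> Hom C z' y" "g = b' \<odot> a'"
    using assms(2) fg(2) by (rule zero_arrE)
  have "\<exists>!u. u \<in> Hom C z z'" using z(1) z'(1) by (simp add: null_object_def)
  then obtain u where u: "u \<in> Hom C z z'" by metis
  have "a' = u \<odot> a" using null_object_uniqueD(1)[OF z'(1) o(1) z'(2)] cmp_hom[OF z(2) u] by blast
  moreover have "b = b' \<odot> u"
    using null_object_uniqueD(2)[OF z(1) o(2) z(3)] cmp_hom[OF u z'(3)] by blast
  ultimately show ?thesis using z(4) z'(4) cmp_assoc[OF z(2) u z'(3)] by simp
qed

lemma kernelD:
  assumes "is_kernel C k f" and f: "f \<in> Hom C x y"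
  shows "k \<in> Hom C (Dom C k) x" and "zero_arr C (f \<odot> k)"
    and "g \<in> Hom C w x \<Longrightarrow> zero_arr C (f \<odot> g) \<Longrightarrow> factors_through C g k"
proof -
  show k: "k \<in> Hom C (Dom C k) x" and z: "zero_arr C (f \<odot> k)"
    using assms by (auto simp: is_kernel_def Hom_def)
  show "factors_through C g k" if "g \<in> Hom C w x" "zero_arr C (f \<odot> g)"
  proof -
    have "g \<in> Arr C" "Cod C g = Dom C f" using that f by (auto simp: Hom_def)
    with assms(1) that(2) show ?thesis
      unfolding is_kernel_def factors_through_def by blast
  qed
qed

text \<open>Cancellation is the uniqueness clause of the kernel property, applied to
  \<open>k \<odot> g\<close>, which \<open>f\<close> sends to zero.\<close>

lemma kernel_in_monos_into:
  assumes ker: "is_kernel C k f" and f: "f \<in> Hom C x y"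
  shows "k \<in> monos_into C x"
proof -
  note k = kernelD(1)[OF assms]
  have "mono_arr C k"
  proof (rule mono_arrI[OF k])
    fix w g h assume g: "g \<in> Hom C w (Dom C k)" and h: "h \<in> Hom C w (Dom C k)"
      and eq: "k \<odot> g = k \<odot> h"
    have kg: "k \<odot> g \<in> Hom C w x" using cmp_hom[OF g k] .
    have zero: "zero_arr C (f \<odot> (k \<odot> g))"
      using zero_arr_cmp_right[OF kernelD(2)[OF assms] cmp_hom[OF k f] g] cmp_assoc[OF g k f] by simp
    have "\<exists>!u. u \<in> Hom C w (Dom C k) \<and> k \<odot> g = k \<odot> u"
    proof -
      have *: "k \<odot> g \<in> Arr C" "Cod C (k \<odot> g) = Dom C f" "Dom C (k \<odot> g) = w"
        using kg f by (simp_all add: Hom_def)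
      show ?thesis
        using ker * zero unfolding is_kernel_def by blast
    qed
    then show "g = h" using g h eq by blast
  qed
  then show ?thesis using k by (auto simp: monos_into_def Hom_def)
qed

section \<open>Consequences of the abelian axioms\<close>

lemma abelian_zero_exists:
  assumes "abelian_category C" "x \<in> Obj C" "y \<in> Obj C"
  shows "\<exists>f\<in>Hom C x y. zero_arr C f"
proof -
  obtain z where z: "null_object C z" using assms(1) unfolding abelian_category_def by blast
  have "\<exists>!g. g \<in> Hom C x z" "\<exists>!h. h \<in> Hom C z y"
    using z assms(2,3) by (simp_all add: null_object_def)
  then obtain g h where "g \<in> Hom C x z" "h \<in> Hom C z y" by metis
  then show ?thesis using zero_arrI[OF z] cmp_hom by blast
qed

lemma abelian_kernel_exists:
  assumes "abelian_category C" "f \<in> Hom C x y"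
  shows "\<exists>k. is_kernel C k f"
proof -
  have "\<forall>f\<in>Arr C. \<exists>k. is_kernel C k f" using assms(1) unfolding abelian_category_def by metis
  with assms(2) show ?thesis by (simp add: Hom_def)
qed

lemma abelian_mono_is_kernel:
  assumes "abelian_category C" "mono_arr C m"
  shows "\<exists>f. is_kernel C m f"
  using assms unfolding abelian_category_def by metis

text \<open>If \<open>m \<odot> f = m \<odot> g\<close>, then \<open>m\<close> kills the difference
  of \<open>f\<close> and \<open>g\<close>, so this difference is zero. The real work is to match
  the neutral element of a hom group with the categorical zero arrow.\<close>

lemma abelian_mono_arrI:
  assumes ab: "abelian_category C" and m: "m \<in> Hom C x y"
    and trivial_ker: "\<And>w g. g \<in> Hom C w x \<Longrightarrow> zero_arr C (m \<odot> g) \<Longrightarrow> zero_arr C g"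
  shows "mono_arr C m"
proof (rule mono_arrI[OF m])
  obtain add where pre: "preadditive C add" using ab unfolding abelian_category_def by blast
  have grp: "\<exists>e. comm_group \<lparr>carrier = Hom C a b, mult = add, one = e\<rparr>"
    if "a \<in> Obj C" "b \<in> Obj C" for a b
    using pre that unfolding preadditive_def by blast
  have distl: "g \<odot> add f f' = add (g \<odot> f) (g \<odot> f')"
    if "f \<in> Hom C a b" "f' \<in> Hom C a b" "g \<in> Hom C b c" for f f' g a b c
    using pre that hom_obj[OF that(1)] hom_obj[OF that(3)] unfolding preadditive_def by blast
  have distr: "add g g' \<odot> f = add (g \<odot> f) (g' \<odot> f)"
    if "f \<in> Hom C a b" "g \<in> Hom C b c" "g' \<in> Hom C b c" for f g g' a b c
    using pre that hom_obj[OF that(1)] hom_obj[OF that(2)] unfolding preadditive_def by blast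
  fix w f g assume f: "f \<in> Hom C w x" and g: "g \<in> Hom C w x" and eq: "m \<odot> f = m \<odot> g"
  note o = hom_obj[OF f]
  obtain e where "comm_group \<lparr>carrier = Hom C w x, mult = add, one = e\<rparr>" using grp o by blast
  then interpret G: comm_group "\<lparr>carrier = Hom C w x, mult = add, one = e\<rparr>" .
  have e: "e \<in> Hom C w x" using G.one_closed by simp
  \<comment> \<open>\<open>preadditive\<close> only provides some neutral element in each hom-set.
    Let the zero arrow \<open>n = b \<odot> a\<close> pass through a null object. Then
    \<open>b\<close> is alone in its hom-set, so \<open>add b b = b\<close>, hence
    \<open>add n n = n\<close> by distributivity, and an idempotent of a group is neutral.\<close>
  have "zero_arr C e"
  proof -
    obtain n where n: "n \<in> Hom C w x" "zero_arr C n" using abelian_zero_exists ab o by blast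
    obtain z a b where z: "null_object C z" "a \<in> Hom C w z" "b \<in> Hom C z x" "n = b \<odot> a"
      using n(2,1) by (rule zero_arrE)
    note zo = hom_obj(1)[OF z(3)]
    obtain e' where "comm_group \<lparr>carrier = Hom C z x, mult = add, one = e'\<rparr>"
      using grp zo o by blast
    then interpret H: comm_group "\<lparr>carrier = Hom C z x, mult = add, one = e'\<rparr>" .
    have "add b b = b"
      using null_object_uniqueD(2)[OF z(1) o(2)] H.m_closed[of b b] z(3) by simp
    then have "add n n = n" using distr[OF z(2,3,3)] z(4) by simp
    then have "n = e" using G.l_cancel_one[of n n] n(1) by simp
    with n show ?thesis by simp
  qed
  define i where "i = inv\<^bsub>\<lparr>carrier = Hom C w x, mult = add, one = e\<rparr>\<^esub> g"
  have i: "i \<in> Hom C w x" using G.inv_closed[of g] g by (simp add: i_def)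
  have gi: "add g i = e" using G.r_inv[of g] g by (simp add: i_def)
  have fi: "add f i \<in> Hom C w x" using G.m_closed[of f i] f i by simp
  \<comment> \<open>Since \<open>m \<odot> f = m \<odot> g\<close>, distributivity expands
    \<open>m \<odot> add f i\<close> and \<open>m \<odot> add g i\<close> to the same sum, and
    \<open>add g i\<close> is \<open>e\<close>.\<close>
  have "m \<odot> add f i = m \<odot> e" using distl[OF f i m] distl[OF g i m] eq gi by simp
  then have "zero_arr C (add f i)"
    using trivial_ker[OF fi] zero_arr_cmp_left[OF \<open>zero_arr C e\<close> e m] by simp
  then have "add f i = add g i"
    using zero_arr_unique[OF _ \<open>zero_arr C e\<close> fi e] gi by simp
  then show "f = g" using G.right_cancel[of i f g] f g i by simp
qed

end

section \<open>Monomorphisms of functor categories\<close>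

context two_categories
begin

text \<open>Both the inclusion \<open>s\<close> of the pointwise kernels and the zero transformation
  \<open>z\<close> become zero after \<open>t\<close>, so cancelling \<open>t\<close> gives
  \<open>s = z\<close>. Thus every kernel \<open>k x\<close> is a zero arrow, which by
  \<open>abelian_mono_arrI\<close> makes \<open>At t x\<close> monic. No abelian structure on the
  functor category is built.\<close>

lemma mono_imp_pointwise_mono:
  assumes ab: "abelian_category D" and mono: "mono_arr (Fun_cat C D) t" and x: "x \<in> Obj C"
  shows "mono_arr D (At t x)"
proof -
  interpret Fun: category "Fun_cat C D" by (rule category_Fun_cat)
  let ?S = "Src t" and ?G = "Trg t"
  have t: "is_ntr C D t" using Fun.mono_arr_in_Arr[OF mono] by simp
  note S = is_ntrD(1)[OF t] and G = is_ntrD(2)[OF t]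
  have tx: "At t x \<in> Hom D (OMap ?S x) (OMap ?G x)" if "x \<in> Obj C" for x
    using is_ntrD(3)[OF t that] .
  have "\<forall>x\<in>Obj C. \<exists>k. is_kernel D k (At t x)"
    using D.abelian_kernel_exists[OF ab tx] by blast
  then obtain k where ker: "\<And>x. x \<in> Obj C \<Longrightarrow> is_kernel D (k x) (At t x)" by metis
  have k: "k x \<in> Hom D (Dom D (k x)) (OMap ?S x)" if "x \<in> Obj C" for x
    using D.kernelD(1)[OF ker[OF that] tx[OF that]] .
  have "\<exists>s. is_ntr C D s \<and> Trg s = ?S \<and> (\<forall>x\<in>Obj C. At s x = k x)"
  proof (rule subfunctor_exists[OF S])
    show "k x \<in> monos_into D (OMap ?S x)" if "x \<in> Obj C" for x
      using D.kernel_in_monos_into[OF ker[OF that] tx[OF that]] .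
    fix f x y assume f: "f \<in> Hom C x y"
    note xy = C.hom_obj[OF f]
    have Sf: "AMap ?S f \<in> Hom D (OMap ?S x) (OMap ?S y)"
      and Gf: "AMap ?G f \<in> Hom D (OMap ?G x) (OMap ?G y)"
      using is_ftrD(2)[OF S f C.category_axioms] is_ftrD(2)[OF G f C.category_axioms] .
    have "At t y \<odot>\<^bsub>D\<^esub> (AMap ?S f \<odot>\<^bsub>D\<^esub> k x) = AMap ?G f \<odot>\<^bsub>D\<^esub> (At t x \<odot>\<^bsub>D\<^esub> k x)"
      using D.cmp_assoc[OF k[OF xy(1)] Sf tx[OF xy(2)]] D.cmp_assoc[OF k[OF xy(1)] tx[OF xy(1)] Gf]
        is_ntrD(4)[OF t f] by simp
    then have "zero_arr D (At t y \<odot>\<^bsub>D\<^esub> (AMap ?S f \<odot>\<^bsub>D\<^esub> k x))"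
      using D.zero_arr_cmp_left[OF D.kernelD(2)[OF ker tx] D.cmp_hom[OF k tx] Gf] xy by simp
    then show "factors_through D (AMap ?S f \<odot>\<^bsub>D\<^esub> k x) (k y)"
      using D.kernelD(3)[OF ker tx D.cmp_hom[OF k Sf]] xy by blast
  qed
  then obtain s where s: "is_ntr C D s" "Trg s = ?S" and sk: "\<And>x. x \<in> Obj C \<Longrightarrow> At s x = k x"
    by blast
  let ?K = "Src s"
  note K = is_ntrD(1)[OF s(1)]
  have sx: "k x \<in> Hom D (OMap ?K x) (OMap ?S x)" if "x \<in> Obj C" for x
    using is_ntrD(3)[OF s(1) that] s(2) sk[OF that] by simp
  have "\<forall>x\<in>Obj C. \<exists>z. z \<in> Hom D (OMap ?K x) (OMap ?S x) \<and> zero_arr D z"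
    using D.abelian_zero_exists[OF ab is_ftrD(1)[OF K] is_ftrD(1)[OF S]] by blast
  then obtain \<zeta> where \<zeta>: "\<And>x. x \<in> Obj C \<Longrightarrow> \<zeta> x \<in> Hom D (OMap ?K x) (OMap ?S x)"
    and zero: "\<And>x. x \<in> Obj C \<Longrightarrow> zero_arr D (\<zeta> x)" by metis
  \<comment> \<open>The components of \<open>z\<close> are natural because parallel zero arrows are
    equal.\<close>
  define z where "z = \<lparr>Src = ?K, Trg = ?S, At = restrict \<zeta> (Obj C)\<rparr>"
  have "is_ntr C D z" unfolding z_def
  proof (rule is_ntrI[OF K S \<zeta>])
    fix f x y assume f: "f \<in> Hom C x y"
    note xy = C.hom_obj[OF f]
    have Sf: "AMap ?S f \<in> Hom D (OMap ?S x) (OMap ?S y)"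
      and Kf: "AMap ?K f \<in> Hom D (OMap ?K x) (OMap ?K y)"
      using is_ftrD(2)[OF S f C.category_axioms] is_ftrD(2)[OF K f C.category_axioms] .
    show "\<zeta> y \<odot>\<^bsub>D\<^esub> AMap ?K f = AMap ?S f \<odot>\<^bsub>D\<^esub> \<zeta> x"
      using D.zero_arr_unique[OF D.zero_arr_cmp_right[OF zero \<zeta> Kf]
          D.zero_arr_cmp_left[OF zero \<zeta> Sf] D.cmp_hom[OF Kf \<zeta>] D.cmp_hom[OF \<zeta> Sf]] xy by blast
  qed
  then have zH: "z \<in> Hom (Fun_cat C D) ?K ?S" by (simp add: Hom_Fun_cat_iff z_def)
  have sH: "s \<in> Hom (Fun_cat C D) ?K ?S" using s by (simp add: Hom_Fun_cat_iff)
  have tH: "t \<in> Hom (Fun_cat C D) ?S ?G" using t by (simp add: Hom_Fun_cat_iff)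
  have ts: "is_ntr C D (t \<odot>\<^bsub>Fun_cat C D\<^esub> s)" "Src (t \<odot>\<^bsub>Fun_cat C D\<^esub> s) = ?K"
      "Trg (t \<odot>\<^bsub>Fun_cat C D\<^esub> s) = ?G"
    using Fun.cmp_hom[OF sH tH] by (auto simp: Hom_Fun_cat_iff)
  have tz: "is_ntr C D (t \<odot>\<^bsub>Fun_cat C D\<^esub> z)" "Src (t \<odot>\<^bsub>Fun_cat C D\<^esub> z) = ?K"
      "Trg (t \<odot>\<^bsub>Fun_cat C D\<^esub> z) = ?G"
    using Fun.cmp_hom[OF zH tH] by (auto simp: Hom_Fun_cat_iff)
  have "t \<odot>\<^bsub>Fun_cat C D\<^esub> s = t \<odot>\<^bsub>Fun_cat C D\<^esub> z"
  proof (rule ntr_eqI[OF ts(1) tz(1)])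
    fix x assume x: "x \<in> Obj C"
    have "At t x \<odot>\<^bsub>D\<^esub> k x = At t x \<odot>\<^bsub>D\<^esub> \<zeta> x"
      by (rule D.zero_arr_unique[OF D.kernelD(2)[OF ker[OF x] tx[OF x]]
            D.zero_arr_cmp_left[OF zero[OF x] \<zeta>[OF x] tx[OF x]]
            D.cmp_hom[OF sx[OF x] tx[OF x]] D.cmp_hom[OF \<zeta>[OF x] tx[OF x]]])
    then show "At (t \<odot>\<^bsub>Fun_cat C D\<^esub> s) x = At (t \<odot>\<^bsub>Fun_cat C D\<^esub> z) x"
      using x by (simp add: At_Cmp_Fun_cat sk z_def)
  qed (use ts tz in auto)
  then have "s = z" by (rule Fun.mono_arrD[OF mono tH sH zH])
  then have "k x = At z x" using sk[OF x] by simp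
  then have k0: "zero_arr D (k x)" using zero[OF x] x by (simp add: z_def)
  show ?thesis
  proof (rule D.abelian_mono_arrI[OF ab tx[OF x]])
    fix w g assume g: "g \<in> Hom D w (OMap ?S x)" and "zero_arr D (At t x \<odot>\<^bsub>D\<^esub> g)"
    then have "factors_through D g (k x)" using D.kernelD(3)[OF ker tx] x by blast
    then obtain u where "u \<in> Hom D w (Dom D (k x))" "g = k x \<odot>\<^bsub>D\<^esub> u"
      using g k[OF x] by (rule D.factors_throughE)
    then show "zero_arr D g" using D.zero_arr_cmp_right[OF k0 k[OF x]] by simp
  qed
qed

end


section \<open>Meets of subobjects\<close>

context category
begin

lemma product_exists:
  fixes I :: "'u set"
  assumes "complete_category TYPE('u) C" "small TYPE('u) I"
    and Y: "\<And>i. i \<in> I \<Longrightarrow> Y i \<in> Obj C"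
  shows "\<exists>c p. c \<in> Obj C \<and> (\<forall>i\<in>I. p i \<in> Hom C c (Y i)) \<and>
    (\<forall>w\<in>Obj C. \<forall>f. (\<forall>i\<in>I. f i \<in> Hom C w (Y i)) \<longrightarrow>
       (\<exists>!h. h \<in> Hom C w c \<and> (\<forall>i\<in>I. p i \<odot> h = f i)))"
proof -
  \<comment> \<open>The discrete category on \<open>I\<close>: each element is an object and also
    its own identity, so the objects and the arrows both form the small set \<open>I\<close>.
    Composable arrows are equal, so a projection serves as composition.\<close>
  define J :: "('u, 'u) cat" where
    "J = \<lparr>Obj = I, Arr = I, Dom = (\<lambda>i. i), Cod = (\<lambda>i. i), Idt = (\<lambda>i. i), Cmp = (\<lambda>g f. f)\<rparr>"
  define F where "F = \<lparr>OMap = restrict Y I, AMap = restrict (\<lambda>i. Idt C (Y i)) I\<rparr>"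
  have ObjJ: "Obj J = I" and ArrJ: "Arr J = I" by (simp_all add: J_def)
  have J: "category J" by unfold_locales (auto simp: J_def Hom_def)
  have idt: "Idt C (Y i) \<in> Hom C (Y i) (Y i)" if "i \<in> I" for i using idt_hom Y that by blast
  have F: "is_ftr J C F"
    unfolding is_ftr_def
    using Y idt cmp_idt_left[OF idt] by (auto simp: J_def F_def Hom_def)
  obtain c p where lim: "is_limit J C F c p"
    using assms(1,2) J F unfolding complete_category_def ObjJ[symmetric] by (metis ArrJ ObjJ)
  \<comment> \<open>All arrows of \<open>J\<close> are identities, so the compatibility condition on
    cones holds automatically and only a family of arrows remains.\<close>
  have cone: "is_cone J C F w f \<longleftrightarrow> w \<in> Obj C \<and> (\<forall>i\<in>I. f i \<in> Hom C w (Y i))" for w f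
    by (auto simp: is_cone_def J_def F_def intro: cmp_idt_left)
  show ?thesis
  proof (intro exI conjI ballI allI impI)
    show "c \<in> Obj C" "\<And>i. i \<in> I \<Longrightarrow> p i \<in> Hom C c (Y i)"
      using lim cone unfolding is_limit_def by blast+
    fix w f assume "w \<in> Obj C" "\<forall>i\<in>I. f i \<in> Hom C w (Y i)"
    then have "is_cone J C F w f" using cone by blast
    then show "\<exists>!h. h \<in> Hom C w c \<and> (\<forall>i\<in>I. p i \<odot> h = f i)"
      using lim unfolding is_limit_def ObjJ by simp
  qed
qed

text \<open>If \<open>m i\<close> is the kernel of \<open>f i : x \<rightarrow> Y i\<close>, then the meet of the \<open>m i\<close> is the kernel of the
  induced arrow from \<open>x\<close> to the product of the \<open>Y i\<close>.  Indexing by the discrete category on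
  \<open>I\<close> is safe even for finite \<open>'u\<close>, where the diagram of a wide pullback over \<open>I\<close> need not be
  small.\<close>

lemma small_meet_exists:
  fixes I :: "'u set"
  assumes ab: "abelian_category C" and comp: "complete_category TYPE('u) C"
    and small: "small TYPE('u) I" and x: "x \<in> Obj C"
    and m: "\<And>i. i \<in> I \<Longrightarrow> m i \<in> monos_into C x"
  shows "\<exists>k. is_meet (m ` I) x k"
proof -
  have "\<forall>i\<in>I. \<exists>f. is_kernel C (m i) f"
    using abelian_mono_is_kernel[OF ab] monos_intoD(1)[OF m] by blast
  then obtain f where ker: "\<And>i. i \<in> I \<Longrightarrow> is_kernel C (m i) (f i)" by metis
  define Y where "Y i = Cod C (f i)" for i
  have f: "f i \<in> Hom C x (Y i)" if "i \<in> I" for i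
    using ker[OF that] m[OF that] by (auto simp: is_kernel_def monos_into_def Hom_def Y_def)
  have "\<exists>c p. c \<in> Obj C \<and> (\<forall>i\<in>I. p i \<in> Hom C c (Y i)) \<and>
    (\<forall>w\<in>Obj C. \<forall>f. (\<forall>i\<in>I. f i \<in> Hom C w (Y i)) \<longrightarrow>
       (\<exists>!h. h \<in> Hom C w c \<and> (\<forall>i\<in>I. p i \<odot> h = f i)))"
    using hom_obj(2)[OF f] by (rule product_exists[OF comp small])
  then obtain c p where c: "c \<in> Obj C" and "\<forall>i\<in>I. p i \<in> Hom C c (Y i)"
    and "\<forall>w\<in>Obj C. \<forall>f. (\<forall>i\<in>I. f i \<in> Hom C w (Y i)) \<longrightarrow>
       (\<exists>!h. h \<in> Hom C w c \<and> (\<forall>i\<in>I. p i \<odot> h = f i))"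
    by (elim exE conjE)
  then have p: "\<And>i. i \<in> I \<Longrightarrow> p i \<in> Hom C c (Y i)"
    and univ: "\<And>w f. w \<in> Obj C \<Longrightarrow> (\<And>i. i \<in> I \<Longrightarrow> f i \<in> Hom C w (Y i)) \<Longrightarrow>
       \<exists>!h. h \<in> Hom C w c \<and> (\<forall>i\<in>I. p i \<odot> h = f i)"
    by simp_all
  \<comment> \<open>An arrow into \<open>x\<close> is killed by \<open>h\<close> iff it is killed by
    every \<open>f i\<close>, that is, iff it factors through every \<open>m i\<close>; hence the
    kernel of \<open>h\<close> is the meet.\<close>
  obtain h where h: "h \<in> Hom C x c" and ph: "\<And>i. i \<in> I \<Longrightarrow> p i \<odot> h = f i"
    using univ[OF x f] by blast
  obtain k where kh: "is_kernel C k h" using abelian_kernel_exists[OF ab h] by blast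
  note k = kernelD(1)[OF kh h]
  have "factors_through C k (m i)" if i: "i \<in> I" for i
  proof (rule kernelD(3)[OF ker[OF i] f[OF i] k])
    have "f i \<odot> k = p i \<odot> (h \<odot> k)" using cmp_assoc[OF k h p[OF i]] ph[OF i] by simp
    then show "zero_arr C (f i \<odot> k)"
      using zero_arr_cmp_left[OF kernelD(2)[OF kh h] cmp_hom[OF k h] p[OF i]] by simp
  qed
  moreover have "factors_through C g k"
    if g: "g \<in> Hom C w x" and fac: "\<And>i. i \<in> I \<Longrightarrow> factors_through C g (m i)" for g w
  proof (rule kernelD(3)[OF kh h g])
    note w = hom_obj(1)[OF g]
    \<comment> \<open>\<open>h \<odot> g\<close> and the zero arrow \<open>z\<close> have the same
      projections, all of them zero, so uniqueness of the induced arrow into the product identifies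
      them.\<close>
    obtain z where z: "z \<in> Hom C w c" "zero_arr C z" using abelian_zero_exists[OF ab w c] by blast
    have "p i \<odot> (h \<odot> g) = p i \<odot> z" if i: "i \<in> I" for i
    proof -
      note mi = monos_intoD(2)[OF m[OF i]]
      obtain u where u: "u \<in> Hom C w (Dom C (m i))" "g = m i \<odot> u"
        using fac[OF i] g mi by (rule factors_throughE)
      have "p i \<odot> (h \<odot> g) = (f i \<odot> m i) \<odot> u"
        using cmp_assoc[OF g h p[OF i]] ph[OF i] u(2) cmp_assoc[OF u(1) mi f[OF i]] by simp
      then have "zero_arr C (p i \<odot> (h \<odot> g))"
        using zero_arr_cmp_right[OF kernelD(2)[OF ker[OF i] f[OF i]] cmp_hom[OF mi f[OF i]] u(1)]
        by simp
      then show ?thesis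
        using zero_arr_unique[OF _ zero_arr_cmp_left[OF z(2,1) p[OF i]]
            cmp_hom[OF cmp_hom[OF g h] p[OF i]] cmp_hom[OF z(1) p[OF i]]] by blast
    qed
    moreover have "\<exists>!v. v \<in> Hom C w c \<and> (\<forall>i\<in>I. p i \<odot> v = p i \<odot> z)"
      by (rule univ[OF w cmp_hom[OF z(1) p]])
    ultimately have "h \<odot> g = z" using cmp_hom[OF g h] z(1) by blast
    then show "zero_arr C (h \<odot> g)" using z(2) by simp
  qed
  ultimately have "is_meet (m ` I) x k"
    unfolding is_meet_def using kernel_in_monos_into[OF kh h] by blast
  then show ?thesis ..
qed

text \<open>\<open>M\<close> need not be small, since one class may contain too many monomorphisms.
  But factoring through a monomorphism depends only on its class, so one representative per class
  suffices, and there are no more classes than subobjects of \<open>x\<close>.\<close>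

lemma meet_exists:
  assumes ab: "abelian_category C" and comp: "complete_category TYPE('u) C"
    and wp: "locally_small TYPE('u) C" and x: "x \<in> Obj C" and M: "M \<subseteq> monos_into C x"
  shows "\<exists>k. is_meet M x k"
proof -
  define cls where "cls m = sub_equiv C x `` {m}" for m
  define P where "P = cls ` M"
  have cls_eq: "factors_through C m n" if "m \<in> M" "n \<in> M" "cls m = cls n" for m n
  proof -
    have "(m, n) \<in> sub_equiv C x"
      using eq_equiv_class[OF that(3)[unfolded cls_def] equiv_sub_equiv] M that(2) by blast
    then show ?thesis by (simp add: sub_equiv_def)
  qed
  have "P \<subseteq> subobjects C x" using M sub_class_in_subobjects by (auto simp: P_def cls_def)
  moreover have "subobjects C x \<prec> (UNIV :: 'u set)"
    using wp x by (simp add: locally_small_def small_def)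
  ultimately have P: "P \<prec> (UNIV :: 'u set)" by (meson subset_imp_lepoll lesspoll_trans1)
  \<comment> \<open>Completeness speaks of index categories inside \<open>'u\<close>, so the set of
    classes is carried into \<open>'u\<close> by an injection; the image is still small.\<close>
  obtain e :: "'a set \<Rightarrow> 'u" where e: "inj_on e P"
    using lesspoll_imp_lepoll[OF P] unfolding lepoll_def by (elim exE conjE)
  have small: "small TYPE('u) (e ` P)"
    unfolding small_def using image_lepoll P by (rule lesspoll_trans1)
  define r where "r = inv_into M cls"
  have r: "r Q \<in> M" "cls (r Q) = Q" if "Q \<in> P" for Q
    using that unfolding r_def P_def by (rule inv_into_into, rule f_inv_into_f)
  have "\<exists>k. is_meet ((\<lambda>i. r (inv_into P e i)) ` (e ` P)) x k"
  proof (rule small_meet_exists[OF ab comp small x])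
    show "r (inv_into P e i) \<in> monos_into C x" if "i \<in> e ` P" for i
      using r(1)[OF inv_into_into[OF that]] M by blast
  qed
  moreover have "(\<lambda>i. r (inv_into P e i)) ` (e ` P) = r ` P"
    using e by (simp add: image_image)
  ultimately obtain k where k: "is_meet (r ` P) x k" by auto
  \<comment> \<open>Each \<open>m\<close> in \<open>M\<close> lies above the representative of its
    own class, so what factors through all representatives factors through all of
    \<open>M\<close>.\<close>
  have sub: "factors_through C g m"
    if g: "g \<in> Hom C w x" and fac: "\<And>n. n \<in> r ` P \<Longrightarrow> factors_through C g n" and m: "m \<in> M"
    for g m w
  proof -
    have Q: "cls m \<in> P" using m by (simp add: P_def)
    have "factors_through C (r (cls m)) m" using cls_eq[OF r(1)[OF Q] m r(2)[OF Q]] .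
    moreover have "r (cls m) \<in> monos_into C x" "m \<in> monos_into C x" using r(1)[OF Q] m M by auto
    ultimately show ?thesis
      using factors_through_trans[OF fac _ g monos_intoD(2) monos_intoD(2)] Q by blast
  qed
  have k_into: "k \<in> monos_into C x" and k_lower: "\<forall>n\<in>r ` P. factors_through C k n"
    and k_univ: "\<forall>w. \<forall>g\<in>Hom C w x. (\<forall>n\<in>r ` P. factors_through C g n) \<longrightarrow> factors_through C g k"
    using k by (auto simp only: is_meet_def)
  have "is_meet M x k"
    unfolding is_meet_def
  proof (intro conjI ballI allI impI)
    show "factors_through C k m" if "m \<in> M" for m
      using sub[OF monos_intoD(2)[OF k_into] bspec[OF k_lower] that] .
    fix w g assume g: "g \<in> Hom C w x" and "\<forall>m\<in>M. factors_through C g m"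
    then have "\<forall>n\<in>r ` P. factors_through C g n" using r(1) by simp
    then show "factors_through C g k" using k_univ g by simp
  qed (fact k_into)
  then show ?thesis ..
qed

end


section \<open>The lattice of preradicals\<close>

theorem corollary7p3:
  fixes C :: "('o, 'a) cat"
  assumes "abelian_category C"
    and "bicomplete TYPE('u) C"
    and "locally_small TYPE('u) C"
  shows "complete_lattice (Pr C)"
proof -
  interpret category C using assms(1) by (simp add: abelian_category_def)
  interpret two_categories C C ..
  interpret Fun: category "Fun_cat C C" by (rule category_Fun_cat)
  have comp: "complete_category TYPE('u) C" using assms(2) by (simp add: bicomplete_def)
  show ?thesis
    unfolding Pr_def
  proof (rule Fun.complete_lattice_SubI)
    fix M assume M: "M \<subseteq> monos_into (Fun_cat C C) (id_ftr C)"
    \<comment> \<open>\<open>mono_imp_pointwise_mono\<close> enters here: evaluating a preradical at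
      \<open>x\<close> yields a genuine monomorphism into \<open>x\<close>.\<close>
    have intoD: "is_ntr C C t" "Trg t = id_ftr C" "\<And>x. x \<in> Obj C \<Longrightarrow> At t x \<in> monos_into C x"
      if "t \<in> monos_into (Fun_cat C C) (id_ftr C)" for t
    proof -
      show t: "is_ntr C C t" "Trg t = id_ftr C"
        using that Fun.mono_arr_in_Arr by (auto simp: monos_into_def)
      show "At t x \<in> monos_into C x" if x: "x \<in> Obj C" for x
        using is_ntrD(3)[OF t(1) x] t(2) mono_imp_pointwise_mono[OF assms(1) _ x]
          \<open>t \<in> monos_into (Fun_cat C C) (id_ftr C)\<close> x
        by (auto simp: monos_into_def Hom_def id_ftr_def)
    qed
    \<comment> \<open>Evaluation turns the collection into a set of monomorphisms into
      \<open>x\<close>, to which \<open>meet_exists\<close> applies whatever the size of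
      \<open>M\<close>.\<close>
    have "\<forall>x\<in>Obj C. \<exists>k. is_meet ((\<lambda>t. At t x) ` M) x k"
      using M intoD(3) by (intro ballI meet_exists[OF assms(1) comp assms(3)]) auto
    then obtain k where meet: "\<And>x. x \<in> Obj C \<Longrightarrow> is_meet ((\<lambda>t. At t x) ` M) x (k x)" by metis
    have k: "k x \<in> monos_into C x" "\<And>t. t \<in> M \<Longrightarrow> factors_through C (k x) (At t x)"
      and k_univ: "\<And>w g. g \<in> Hom C w x \<Longrightarrow> (\<And>t. t \<in> M \<Longrightarrow> factors_through C g (At t x)) \<Longrightarrow>
        factors_through C g (k x)" if "x \<in> Obj C" for x
      using meet[OF that] unfolding is_meet_def by blast+
    have "\<exists>s. is_ntr C C s \<and> Trg s = id_ftr C \<and> (\<forall>x\<in>Obj C. At s x = k x)"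
    proof (rule subfunctor_exists[OF is_ftr_id_ftr])
      show "k x \<in> monos_into C (OMap (id_ftr C) x)" if "x \<in> Obj C" for x
        using k(1)[OF that] that by (simp add: id_ftr_def)
      fix f x y assume f: "f \<in> Hom C x y"
      note xy = hom_obj[OF f]
      note kx = monos_intoD(2)[OF k(1)[OF xy(1)]]
      \<comment> \<open>\<open>k x\<close> factors through \<open>At t x\<close>, and naturality of
        \<open>t\<close> carries \<open>f\<close> across, so \<open>f \<odot> k x\<close> factors
        through \<open>At t y\<close>.\<close>
      have "factors_through C (f \<odot>\<^bsub>C\<^esub> k x) (At t y)" if t: "t \<in> M" for t
      proof -
        have t': "t \<in> monos_into (Fun_cat C C) (id_ftr C)" using M t by blast
        note into = intoD[OF t']
        let ?T = "Src t"
        have tx: "At t x \<in> Hom C (OMap ?T x) x" and ty: "At t y \<in> Hom C (OMap ?T y) y"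
          using is_ntrD(3)[OF into(1)] into(2) xy by (auto simp: id_ftr_def)
        have Tf: "AMap ?T f \<in> Hom C (OMap ?T x) (OMap ?T y)"
          using is_ftrD(2)[OF is_ntrD(1)[OF into(1)] f category_axioms] .
        have nat: "f \<odot>\<^bsub>C\<^esub> At t x = At t y \<odot>\<^bsub>C\<^esub> AMap ?T f"
          using is_ntrD(4)[OF into(1) f] into(2) f by (simp add: id_ftr_def Hom_def)
        obtain u where u: "u \<in> Hom C (Dom C (k x)) (OMap ?T x)" "k x = At t x \<odot>\<^bsub>C\<^esub> u"
          using k(2)[OF xy(1) t] kx tx by (rule factors_throughE)
        have "f \<odot>\<^bsub>C\<^esub> k x = (At t y \<odot>\<^bsub>C\<^esub> AMap ?T f) \<odot>\<^bsub>C\<^esub> u"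
          using cmp_assoc[OF u(1) tx f] u(2) nat by simp
        also have "\<dots> = At t y \<odot>\<^bsub>C\<^esub> (AMap ?T f \<odot>\<^bsub>C\<^esub> u)"
          by (rule cmp_assoc[OF u(1) Tf ty])
        finally show ?thesis by (rule factors_throughI[OF cmp_hom[OF kx f] ty cmp_hom[OF u(1) Tf]])
      qed
      then show "factors_through C (AMap (id_ftr C) f \<odot>\<^bsub>C\<^esub> k x) (k y)"
        using k_univ[OF xy(2) cmp_hom[OF kx f]] f by (simp add: id_ftr_def Hom_def)
    qed
    then obtain s where s: "is_ntr C C s" "Trg s = id_ftr C"
      and sk: "\<And>x. x \<in> Obj C \<Longrightarrow> At s x = k x" by blast
    have s_mono: "mono_arr C (At s x)" if "x \<in> Obj C" for x
      using monos_intoD(1)[OF k(1)] sk that by simp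
    have s_into: "s \<in> monos_into (Fun_cat C C) (id_ftr C)"
      using pointwise_mono_imp_mono[OF s(1) s_mono] s(2) by (simp add: monos_into_def)
    have "factors_through (Fun_cat C C) g s \<longleftrightarrow> (\<forall>t\<in>M. factors_through (Fun_cat C C) g t)"
      if g: "g \<in> monos_into (Fun_cat C C) (id_ftr C)" for g
    proof
      assume gs: "factors_through (Fun_cat C C) g s"
      show "\<forall>t\<in>M. factors_through (Fun_cat C C) g t"
      proof
        fix t assume t: "t \<in> M"
        then have t': "t \<in> monos_into (Fun_cat C C) (id_ftr C)" using M by blast
        \<comment> \<open>The meets lie below \<open>t\<close> only object by object; the monic
          components of \<open>t\<close> assemble these factorizations into a
          transformation.\<close>
        have "factors_through (Fun_cat C C) s t"
          using intoD(1,2)[OF t'] monos_intoD(1)[OF intoD(3)[OF t']] s k(2) sk t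
          by (intro pointwise_factors_through) auto
        then show "factors_through (Fun_cat C C) g t"
          using Fun.factors_through_trans_monos[OF gs _ g s_into t'] by blast
      qed
    next
      assume gM: "\<forall>t\<in>M. factors_through (Fun_cat C C) g t"
      show "factors_through (Fun_cat C C) g s"
      \<comment> \<open>Now the components of \<open>s\<close> are the monomorphisms that force
        naturality, and the universal property of each meet provides the factorization.\<close>
      proof (rule pointwise_factors_through[OF intoD(1)[OF g] s(1) _ s_mono])
        fix x assume x: "x \<in> Obj C"
        have "factors_through C (At g x) (At t x)" if t: "t \<in> M" for t
        proof -
          have t': "t \<in> monos_into (Fun_cat C C) (id_ftr C)" using M t by blast
          show ?thesis
            using factors_through_pointwise[OF intoD(1)[OF g] intoD(1)[OF t'] _ _ x]
              intoD(2)[OF g] intoD(2)[OF t'] gM t by simp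
        qed
        then show "factors_through C (At g x) (At s x)"
          using k_univ[OF x monos_intoD(2)[OF intoD(3)[OF g x]]] sk[OF x] by simp
      qed (use intoD[OF g] s in auto)
    qed
    then show "\<exists>s\<in>monos_into (Fun_cat C C) (id_ftr C). \<forall>g\<in>monos_into (Fun_cat C C) (id_ftr C).
        factors_through (Fun_cat C C) g s \<longleftrightarrow> (\<forall>t\<in>M. factors_through (Fun_cat C C) g t)"
      using s_into by blast
  qed
qed

end
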